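(* Let $\mathfrak{g}$ be a semisimple Lie algebra and let $\widetilde{\mathfrak{g}}$ be an infinite-dimensional Lie algebra of $\mathfrak{g}$-valued functions of one complex variable $u$. Let $R:\widetilde{\mathfrak{g}}\to\widetilde{\mathfrak{g}}$ be a classical $R$-operator, i.e. a linear operator with $R([R(X),Y]+[X,R(Y)])-[R(X),R(Y)]=[X,Y]$ for all $X,Y\in\widetilde{\mathfrak{g}}$. Let $L(u)$ be the generic element of the dual space $\widetilde{\mathfrak{g}}^*$, and let $I_k(L(u))$ be Casimir functions on $\widetilde{\mathfrak{g}}^*$ such that the functions $$I_k^{R_\pm}(L(u)) := I_k\big((R^*\pm 1)(L(u))\big)$$ are finite polynomials on $\widetilde{\mathfrak{g}}^*$. Let $t_k^{\pm}$ denote the parameter along the trajectories of the Hamiltonian flow generated by $I_k^{R_\pm}$. Then the $\widetilde{\mathfrak{g}}$-valued functions $\nabla I_k^{R_\pm}(L(u))$ satisfy, for all $k,l$, the zero-curvature equations $$\frac{\partial \nabla I_k^{R_\pm}(L(u))}{\partial t_l^{\pm}}-\frac{\partial \nabla I_l^{R_\pm}(L(u))}{\partial t_k^{\pm}}+\big[\nabla I_k^{R_\pm}(L(u)),\nabla I_l^{R_\pm}(L(u))\big]=0,$$ $$\frac{\partial \nabla I_k^{R_\pm}(L(u))}{\partial t_l^{\mp}}-\frac{\partial \nabla I_l^{R_\mp}(L(u))}{\partial t_k^{\pm}}+\big[\nabla I_k^{R_\pm}(L(u)),\nabla I_l^{R_\mp}(L(u))\big]=0,$$ where in each equation either all upper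 signs or all lower signs are taken.
   Context: Let $\{X_i\}$ be a basis of $\widetilde{\mathfrak{g}}$, let $\langle\ ,\ \rangle:\widetilde{\mathfrak{g}}^*\times\widetilde{\mathfrak{g}}\to\mathbb{C}$ be the pairing, and let $\{X_i^*\}$ be the dual basis, $\langle X_j^*,X_i\rangle=\delta_{ij}$. The generic element of $\widetilde{\mathfrak{g}}^*$ is the (possibly infinite, formal) sum $L=\sum_i L_iX_i^*$, where the $L_i$ are the coordinate functions on $\widetilde{\mathfrak{g}}^*$. The notation $L(u)$ indicates that elements are functions of $u$. For a function $F$ on $\widetilde{\mathfrak{g}}^*$ its algebra-valued gradient is $\nabla F(L)=\sum_i\frac{\partial F(L)}{\partial L_i}X_i$. The Lie--Poisson bracket is $\{F_1,F_2\}(L)=\langle L,[\nabla F_1,\nabla F_2]\rangle$. A Casimir function is an invariant of the coadjoint representation of $\widetilde{\mathfrak{g}}$ (possibly a formal power series in the coordinates $L_i$). The operator $R^*$ on $\widetilde{\mathfrak{g}}^*$ is the dual of $R$: $\langle R^*(Y),X\rangle=\langle Y,R(X)\rangle$. "Finite polynomial" means a polynomial in finitely many of the coordinates $L_i$, so that its gradient is a finite linear combination of the $X_i$. The Hamiltonian flow of $H=I_k^{R_\pm}$ with time $t_k^\pm$ is $\frac{dL_i}{dt_k^\pm}=\{L_i,I_k^{R_\pm}(L)\}$. The derivative $\partial/\partial t_k^\pm$ of a $\widetilde{\mathfrak{g}}$-valued function of $L$ is its derivative along this flow (coefficientwise in the $X_i$). *)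

theory Defs
  imports "HOL-Analysis.Analysis" "HOL-Library.Function_Algebras" "HOL-Library.Poly_Mapping"
begin

section \<open>Complex Lie algebras\<close>

class complex_lie_algebra = ab_group_add +
  fixes cscale :: "complex \<Rightarrow> 'a \<Rightarrow> 'a"  (infixr "*\<^sub>C" 75)
    and lie :: "'a \<Rightarrow> 'a \<Rightarrow> 'a"  ("\<^bold>[_,/ _\<^bold>]")
  assumes cscale_add_right: "a *\<^sub>C (x + y) = a *\<^sub>C x + a *\<^sub>C y"
    and cscale_add_left: "(a + b) *\<^sub>C x = a *\<^sub>C x + b *\<^sub>C x"
    and cscale_cscale: "a *\<^sub>C b *\<^sub>C x = (a * b) *\<^sub>C x"
    and cscale_one: "1 *\<^sub>C x = x"
    and lie_add_left: "\<^bold>[x + y, z\<^bold>] = \<^bold>[x, z\<^bold>] + \<^bold>[y, z\<^bold>]"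
    and lie_add_right: "\<^bold>[x, y + z\<^bold>] = \<^bold>[x, y\<^bold>] + \<^bold>[x, z\<^bold>]"
    and lie_cscale_left: "\<^bold>[a *\<^sub>C x, y\<^bold>] = a *\<^sub>C \<^bold>[x, y\<^bold>]"
    and lie_cscale_right: "\<^bold>[x, a *\<^sub>C y\<^bold>] = a *\<^sub>C \<^bold>[x, y\<^bold>]"
    and lie_self: "\<^bold>[x, x\<^bold>] = 0"
    and lie_jacobi: "\<^bold>[x, \<^bold>[y, z\<^bold>]\<^bold>] + \<^bold>[y, \<^bold>[z, x\<^bold>]\<^bold>] + \<^bold>[z, \<^bold>[x, y\<^bold>]\<^bold>] = 0"

global_interpretation cvec: vector_space "cscale :: complex \<Rightarrow> 'a \<Rightarrow> 'a::complex_lie_algebra"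
  by unfold_locales (simp_all add: cscale_add_right cscale_add_left cscale_cscale cscale_one)

instantiation "fun" :: (type, complex_lie_algebra) complex_lie_algebra
begin

definition cscale_fun :: "complex \<Rightarrow> ('a \<Rightarrow> 'b) \<Rightarrow> 'a \<Rightarrow> 'b"
  where "cscale_fun c f = (\<lambda>u. c *\<^sub>C f u)"

definition lie_fun :: "('a \<Rightarrow> 'b) \<Rightarrow> ('a \<Rightarrow> 'b) \<Rightarrow> 'a \<Rightarrow> 'b"
  where "lie_fun f g = (\<lambda>u. \<^bold>[f u, g u\<^bold>])"

instance
  by intro_classes
    (simp_all add: cscale_fun_def lie_fun_def fun_eq_iff plus_fun_def zero_fun_def
      cscale_add_right cscale_add_left cscale_cscale cscale_one
      lie_add_left lie_add_right lie_cscale_left lie_cscale_right lie_self lie_jacobi)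

end

definition lie_ideal :: "'a::complex_lie_algebra set \<Rightarrow> bool"
  where "lie_ideal I \<longleftrightarrow> cvec.subspace I \<and> (\<forall>x. \<forall>y\<in>I. \<^bold>[x, y\<^bold>] \<in> I)"

primrec derived_series :: "nat \<Rightarrow> 'a::complex_lie_algebra set \<Rightarrow> 'a set"
  where
    "derived_series 0 I = I"
  | "derived_series (Suc n) I =
      cvec.span {\<^bold>[x, y\<^bold>] |x y. x \<in> derived_series n I \<and> y \<in> derived_series n I}"

definition solvable_ideal :: "'a::complex_lie_algebra set \<Rightarrow> bool"
  where "solvable_ideal I \<longleftrightarrow> lie_ideal I \<and> (\<exists>n. derived_series n I = {0})"

text \<open>Semisimplicity of a finite-dimensional Lie algebra: its radical vanishes.\<close>

definition semisimple_lie_algebra :: "'g::complex_lie_algebra itself \<Rightarrow> bool"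
  where "semisimple_lie_algebra _ \<longleftrightarrow>
    (\<exists>B :: 'g set. finite B \<and> cvec.span B = UNIV) \<and>
    (\<forall>I :: 'g set. solvable_ideal I \<longrightarrow> I = {0})"


section \<open>Lie algebras of functions, bases and the dual space\<close>

text \<open>
  Functions carry the pointwise bracket. Functions defined only on a subset of the plane
  (for example away from some poles) are represented by their extension by zero.
\<close>

definition infinite_dim_function_lie_algebra :: "(complex \<Rightarrow> 'g::complex_lie_algebra) set \<Rightarrow> bool"
  where "infinite_dim_function_lie_algebra G \<longleftrightarrow>
    cvec.subspace G \<and> (\<forall>x\<in>G. \<forall>y\<in>G. \<^bold>[x, y\<^bold>] \<in> G) \<and>
    (\<nexists>B. finite B \<and> G \<subseteq> cvec.span B)"

definition indexed_basis :: "('i \<Rightarrow> 'v::complex_lie_algebra) \<Rightarrow> 'v set \<Rightarrow> bool"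
  where "indexed_basis X G \<longleftrightarrow>
    inj X \<and> cvec.independent (range X) \<and> cvec.span (range X) = G"

definition coord :: "('i \<Rightarrow> 'v::complex_lie_algebra) \<Rightarrow> 'v \<Rightarrow> 'i \<Rightarrow> complex"
  where "coord X x i = cvec.representation (range X) x (X i)"

text \<open>
  The formal sum \<open>\<Sum>i. L i X\<^sub>i\<^sup>*\<close> is represented by its family of coordinates \<open>L :: 'i \<Rightarrow> complex\<close>,
  so that \<open>X\<^sub>j\<^sup>*\<close> is \<open>\<lambda>i. if i = j then 1 else 0\<close>.
  The sum below has only finitely many terms.
\<close>

definition pairing :: "('i \<Rightarrow> 'v::complex_lie_algebra) \<Rightarrow> ('i \<Rightarrow> complex) \<Rightarrow> 'v \<Rightarrow> complex"
  where "pairing X L x = (\<Sum>i | coord X x i \<noteq> 0. L i * coord X x i)"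

text \<open>The coadjoint action, \<open>\<langle>ad\<^sup>*\<^sub>x L, y\<rangle> = - \<langle>L, [x, y]\<rangle>\<close>.\<close>

definition coad :: "('i \<Rightarrow> 'v::complex_lie_algebra) \<Rightarrow> 'v \<Rightarrow> ('i \<Rightarrow> complex) \<Rightarrow> 'i \<Rightarrow> complex"
  where "coad X x L = (\<lambda>i. - pairing X L \<^bold>[x, X i\<^bold>])"

text \<open>The dual operator, \<open>\<langle>R\<^sup>* L, x\<rangle> = \<langle>L, R x\<rangle>\<close>.\<close>

definition dual_op :: "('i \<Rightarrow> 'v::complex_lie_algebra) \<Rightarrow> ('v \<Rightarrow> 'v) \<Rightarrow> ('i \<Rightarrow> complex) \<Rightarrow> 'i \<Rightarrow> complex"
  where "dual_op X R L = (\<lambda>i. pairing X L (R (X i)))"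

definition classical_R_operator :: "'v::complex_lie_algebra set \<Rightarrow> ('v \<Rightarrow> 'v) \<Rightarrow> bool"
  where "classical_R_operator G R \<longleftrightarrow>
    (\<forall>x\<in>G. R x \<in> G) \<and>
    (\<forall>x\<in>G. \<forall>y\<in>G. R (x + y) = R x + R y) \<and>
    (\<forall>c. \<forall>x\<in>G. R (c *\<^sub>C x) = c *\<^sub>C R x) \<and>
    (\<forall>x\<in>G. \<forall>y\<in>G. R (\<^bold>[R x, y\<^bold>] + \<^bold>[x, R y\<^bold>]) - \<^bold>[R x, R y\<^bold>] = \<^bold>[x, y\<^bold>])"

text \<open>
  A dual space of \<open>G\<close>: any space of formal sums that contains the dual basis and carries the
  coadjoint representation and the operator \<open>R\<^sup>*\<close>. The full algebraic dual \<open>UNIV\<close> always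
  qualifies; so does the span of the dual basis when it is stable under these operators.
\<close>

definition is_dual_space ::
    "('i \<Rightarrow> 'v::complex_lie_algebra) \<Rightarrow> 'v set \<Rightarrow> ('v \<Rightarrow> 'v) \<Rightarrow> ('i \<Rightarrow> complex) set \<Rightarrow> bool"
  where "is_dual_space X G R D \<longleftrightarrow>
    (\<forall>j. (\<lambda>i. if i = j then 1 else 0) \<in> D) \<and>
    (\<forall>L\<in>D. \<forall>M\<in>D. (\<lambda>i. L i + M i) \<in> D) \<and>
    (\<forall>c. \<forall>L\<in>D. (\<lambda>i. c * L i) \<in> D) \<and>
    (\<forall>x\<in>G. \<forall>L\<in>D. coad X x L \<in> D) \<and>
    (\<forall>L\<in>D. dual_op X R L \<in> D)"


section \<open>Polynomials and formal power series in the coordinates\<close>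

type_synonym 'i fseries = "('i \<Rightarrow>\<^sub>0 nat) \<Rightarrow> complex"
type_synonym 'i fpoly = "('i \<Rightarrow>\<^sub>0 nat) \<Rightarrow>\<^sub>0 complex"

definition monomial_degree :: "('i \<Rightarrow>\<^sub>0 nat) \<Rightarrow> nat"
  where "monomial_degree m = (\<Sum>i\<in>Poly_Mapping.keys m. Poly_Mapping.lookup m i)"

definition monomial_at :: "('i \<Rightarrow>\<^sub>0 nat) \<Rightarrow> ('i \<Rightarrow> complex) \<Rightarrow> complex"
  where "monomial_at m L = (\<Prod>i\<in>Poly_Mapping.keys m. L i ^ Poly_Mapping.lookup m i)"

definition poly_fun :: "'i fpoly \<Rightarrow> ('i \<Rightarrow> complex) \<Rightarrow> complex"
  where "poly_fun P L = (\<Sum>m\<in>Poly_Mapping.keys P. Poly_Mapping.lookup P m * monomial_at m L)"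

text \<open>
  A formal power series in infinitely many coordinates is evaluated at a point degree by degree,
  so that infinitely many degrees raise no question of convergence; within one degree
  only finitely many terms may be nonzero. The value at \<open>L\<close> is the sequence
  \<open>n \<mapsto> hom_part c n L\<close>, the coefficients of \<open>c (z L)\<close> as a formal power series in \<open>z\<close>.
\<close>

definition hom_terms :: "'i fseries \<Rightarrow> nat \<Rightarrow> ('i \<Rightarrow> complex) \<Rightarrow> ('i \<Rightarrow>\<^sub>0 nat) set"
  where "hom_terms c n L = {m. monomial_degree m = n \<and> c m * monomial_at m L \<noteq> 0}"

definition defined_at :: "'i fseries \<Rightarrow> ('i \<Rightarrow> complex) \<Rightarrow> bool"
  where "defined_at c L \<longleftrightarrow> (\<forall>n. finite (hom_terms c n L))"

definition hom_part :: "'i fseries \<Rightarrow> nat \<Rightarrow> ('i \<Rightarrow> complex) \<Rightarrow> complex"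
  where "hom_part c n L = (\<Sum>m\<in>hom_terms c n L. c m * monomial_at m L)"

text \<open>
  Invariance under the coadjoint representation: wherever the series makes sense along a
  coadjoint direction, its derivative in that direction vanishes.
  If \<open>D\<close> is the span of the dual basis, the series makes sense everywhere on \<open>D\<close>.
\<close>

definition casimir ::
    "('i \<Rightarrow> 'v::complex_lie_algebra) \<Rightarrow> 'v set \<Rightarrow> ('i \<Rightarrow> complex) set \<Rightarrow> 'i fseries \<Rightarrow> bool"
  where "casimir X G D c \<longleftrightarrow>
    (\<forall>L\<in>D. \<forall>x\<in>G.
      (\<forall>s. defined_at c (\<lambda>i. L i + s * coad X x L i)) \<longrightarrow>
      (\<forall>n. ((\<lambda>s. hom_part c n (\<lambda>i. L i + s * coad X x L i)) has_field_derivative 0) (at 0)))"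

text \<open>The function \<open>L \<mapsto> c ((R\<^sup>* + \<sigma>) L)\<close> is defined and is the finite polynomial \<open>P\<close>.\<close>

definition R_shift_is_poly ::
    "('i \<Rightarrow> 'v::complex_lie_algebra) \<Rightarrow> ('v \<Rightarrow> 'v) \<Rightarrow> ('i \<Rightarrow> complex) set \<Rightarrow> 'i fseries \<Rightarrow> complex \<Rightarrow>
      'i fpoly \<Rightarrow> bool"
  where "R_shift_is_poly X R D c \<sigma> P \<longleftrightarrow>
    (\<forall>L\<in>D.
      defined_at c (\<lambda>i. dual_op X R L i + \<sigma> * L i) \<and>
      (\<forall>n. hom_part c n (\<lambda>i. dual_op X R L i + \<sigma> * L i) = hom_part (Poly_Mapping.lookup P) n L))"


section \<open>Gradients, Lie--Poisson bracket and Hamiltonian flows\<close>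

definition partial_deriv :: "(('i \<Rightarrow> complex) \<Rightarrow> complex) \<Rightarrow> 'i \<Rightarrow> ('i \<Rightarrow> complex) \<Rightarrow> complex"
  where "partial_deriv F i L = deriv (\<lambda>z. F (L(i := z))) (L i)"

text \<open>
  The sums in \<open>gradient\<close> and \<open>flow_deriv\<close> have finitely many terms for functions
  of finitely many coordinates.
\<close>

definition gradient ::
    "('i \<Rightarrow> 'v::complex_lie_algebra) \<Rightarrow> (('i \<Rightarrow> complex) \<Rightarrow> complex) \<Rightarrow> ('i \<Rightarrow> complex) \<Rightarrow> 'v"
  where "gradient X F L = (\<Sum>i | partial_deriv F i L \<noteq> 0. partial_deriv F i L *\<^sub>C X i)"

definition lie_poisson ::
    "('i \<Rightarrow> 'v::complex_lie_algebra) \<Rightarrow> (('i \<Rightarrow> complex) \<Rightarrow> complex) \<Rightarrow> (('i \<Rightarrow> complex) \<Rightarrow> complex) \<Rightarrow>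
      ('i \<Rightarrow> complex) \<Rightarrow> complex"
  where "lie_poisson X F H L = pairing X L \<^bold>[gradient X F L, gradient X H L\<^bold>]"

text \<open>The velocity of the Hamiltonian flow, \<open>dL\<^sub>i/dt = {L\<^sub>i, H}\<close>.\<close>

definition hamiltonian_velocity ::
    "('i \<Rightarrow> 'v::complex_lie_algebra) \<Rightarrow> (('i \<Rightarrow> complex) \<Rightarrow> complex) \<Rightarrow> ('i \<Rightarrow> complex) \<Rightarrow> 'i \<Rightarrow> complex"
  where "hamiltonian_velocity X H L = (\<lambda>i. lie_poisson X (\<lambda>M. M i) H L)"

text \<open>
  The derivative of the \<open>i\<close>-th coordinate of an algebra-valued function along the flow of \<open>H\<close>,
  and the derivative of the function itself.
\<close>

definition flow_deriv_coord ::
    "('i \<Rightarrow> 'v::complex_lie_algebra) \<Rightarrow> (('i \<Rightarrow> complex) \<Rightarrow> complex) \<Rightarrow> (('i \<Rightarrow> complex) \<Rightarrow> 'v) \<Rightarrow>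
      ('i \<Rightarrow> complex) \<Rightarrow> 'i \<Rightarrow> complex"
  where "flow_deriv_coord X H \<Phi> L i =
    deriv (\<lambda>s. coord X (\<Phi> (\<lambda>j. L j + s * hamiltonian_velocity X H L j)) i) 0"

definition flow_deriv ::
    "('i \<Rightarrow> 'v::complex_lie_algebra) \<Rightarrow> (('i \<Rightarrow> complex) \<Rightarrow> complex) \<Rightarrow> (('i \<Rightarrow> complex) \<Rightarrow> 'v) \<Rightarrow>
      ('i \<Rightarrow> complex) \<Rightarrow> 'v"
  where "flow_deriv X H \<Phi> L =
    (\<Sum>i | flow_deriv_coord X H \<Phi> L i \<noteq> 0. flow_deriv_coord X H \<Phi> L i *\<^sub>C X i)"

end

theory Submission
  imports Defs
begin

text \<open>
  For polynomial Hamiltonians \<open>f\<close>, \<open>h\<close> the zero-curvature expression is the gradient of \<open>{f, h}\<close>, so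
  it suffices that the functions \<open>I\<^sub>k((R\<^sup>* \<plusminus> 1) L)\<close> are pairwise in involution. If \<open>\<nabla>f\<close> is the
  gradient of one of them, invariance of \<open>I\<^sub>k\<close> and the equation for \<open>R\<close> give
  \<open>\<langle>L, [\<nabla>f, R y]\<rangle> = \<langle>L, R [\<nabla>f, y]\<rangle>\<close> for all \<open>y\<close>, that is, the coadjoint action of \<open>\<nabla>f\<close> on \<open>L\<close>
  commutes with \<open>R\<^sup>*\<close>. The coadjoint direction of \<open>\<nabla>f\<close> at \<open>L\<close> is thus mapped by \<open>R\<^sup>* \<plusminus> 1\<close>
  (either sign) to a coadjoint direction at \<open>(R\<^sup>* \<plusminus> 1) L\<close>, along which \<open>I\<^sub>l\<close> is constant.
\<close>

section \<open>Polynomial functions of the coordinates and their derivatives\<close>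

text \<open>Polynomials are treated as functions, so that the rules of calculus follow by rule
  induction. The set \<open>V\<close> bounds the variables; when finite, it is a range of summation
  common to several polynomials and to all points.\<close>

inductive coord_poly :: "'i set \<Rightarrow> (('i \<Rightarrow> complex) \<Rightarrow> complex) \<Rightarrow> bool" for V where
  const: "coord_poly V (\<lambda>L. c)"
| var: "i \<in> V \<Longrightarrow> coord_poly V (\<lambda>L. L i)"
| add: "coord_poly V f \<Longrightarrow> coord_poly V g \<Longrightarrow> coord_poly V (\<lambda>L. f L + g L)"
| mult: "coord_poly V f \<Longrightarrow> coord_poly V g \<Longrightarrow> coord_poly V (\<lambda>L. f L * g L)"

lemma coord_poly_sum: "(\<And>x. x \<in> A \<Longrightarrow> coord_poly V (f x)) \<Longrightarrow> coord_poly V (\<lambda>L. \<Sum>x\<in>A. f x L)"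
  by (induction A rule: infinite_finite_induct) (auto intro: coord_poly.intros)

lemma coord_poly_prod: "(\<And>x. x \<in> A \<Longrightarrow> coord_poly V (f x)) \<Longrightarrow> coord_poly V (\<lambda>L. \<Prod>x\<in>A. f x L)"
  by (induction A rule: infinite_finite_induct) (auto intro: coord_poly.intros)

lemma coord_poly_power: "coord_poly V f \<Longrightarrow> coord_poly V (\<lambda>L. f L ^ n)"
  by (induction n) (auto intro: coord_poly.intros)

lemma coord_poly_poly_fun:
  assumes "(\<Union>m\<in>Poly_Mapping.keys P. Poly_Mapping.keys m) \<subseteq> V"
  shows "coord_poly V (poly_fun P)"
proof -
  have "coord_poly V (\<lambda>L. \<Sum>m\<in>Poly_Mapping.keys P. Poly_Mapping.lookup P m *
      (\<Prod>i\<in>Poly_Mapping.keys m. L i ^ Poly_Mapping.lookup m i))"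
    by (intro coord_poly_sum coord_poly.mult coord_poly.const coord_poly_prod coord_poly_power
        coord_poly.var) (use assms in auto)
  then show ?thesis
    by (simp add: poly_fun_def[abs_def] monomial_at_def)
qed

lemma coord_poly_cong:
  assumes "coord_poly V f" "\<And>i. i \<in> V \<Longrightarrow> L i = M i"
  shows "f L = f M"
  using assms by induction auto

text \<open>\<open>partial_deriv\<close> is built on \<open>deriv\<close>, which is meaningful only
  where the function is differentiable. This supplies a genuine derivative, from which the sum and
  product rules follow by uniqueness.\<close>

lemma has_partial_deriv:
  assumes "coord_poly V f"
  shows "((\<lambda>z. f (L(i := z))) has_field_derivative partial_deriv f i L) (at (L i))"
proof -
  have "(\<lambda>z. f (L(i := z))) field_differentiable (at (L i))"
    using assms
  proof induction
    case (var j)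
    then show ?case by (cases "j = i") (auto intro: derivative_intros)
  qed (auto intro: derivative_intros)
  then show ?thesis
    by (simp add: partial_deriv_def DERIV_deriv_iff_field_differentiable)
qed

lemma partial_deriv_const: "partial_deriv (\<lambda>L. c) i = (\<lambda>L. 0)"
  by (simp add: partial_deriv_def fun_eq_iff)

lemma partial_deriv_var: "partial_deriv (\<lambda>L. L j) i = (\<lambda>L. if i = j then 1 else 0)"
  by (auto simp: partial_deriv_def fun_eq_iff)

lemma partial_deriv_add:
  assumes "coord_poly V f" "coord_poly V g"
  shows "partial_deriv (\<lambda>L. f L + g L) i = (\<lambda>L. partial_deriv f i L + partial_deriv g i L)"
proof
  fix L
  from DERIV_add[OF assms[THEN has_partial_deriv, of L i]]
  show "partial_deriv (\<lambda>L. f L + g L) i L = partial_deriv f i L + partial_deriv g i L"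
    unfolding partial_deriv_def[of "\<lambda>L. f L + g L"] by (rule DERIV_imp_deriv)
qed

lemma partial_deriv_mult:
  assumes "coord_poly V f" "coord_poly V g"
  shows "partial_deriv (\<lambda>L. f L * g L) i =
    (\<lambda>L. partial_deriv f i L * g L + f L * partial_deriv g i L)"
proof
  fix L
  from DERIV_mult[OF assms[THEN has_partial_deriv, of L i]]
  show "partial_deriv (\<lambda>L. f L * g L) i L = partial_deriv f i L * g L + f L * partial_deriv g i L"
    unfolding partial_deriv_def[of "\<lambda>L. f L * g L"] by (auto dest: DERIV_imp_deriv simp: mult.commute)
qed

lemmas partial_deriv_rules =
  partial_deriv_const partial_deriv_var partial_deriv_add partial_deriv_mult

lemma coord_poly_partial_deriv: "coord_poly V f \<Longrightarrow> coord_poly V (partial_deriv f i)"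
  by (induction rule: coord_poly.induct)
    (auto simp: partial_deriv_rules intro: coord_poly.intros)

lemma partial_deriv_eq_0: "coord_poly V f \<Longrightarrow> i \<notin> V \<Longrightarrow> partial_deriv f i L = 0"
  by (induction rule: coord_poly.induct) (auto simp: partial_deriv_rules)

text \<open>In the product case, two applications of the product rule give four terms that an
  exchange of \<open>i\<close> and \<open>j\<close> merely permutes, up to the induction
  hypotheses.\<close>

lemma partial_deriv_commute:
  "coord_poly V f \<Longrightarrow> partial_deriv (partial_deriv f i) j = partial_deriv (partial_deriv f j) i"
proof (induction rule: coord_poly.induct)
  case (mult f g)
  have rule: "partial_deriv (\<lambda>L. partial_deriv f i L * g L + f L * partial_deriv g i L) j =
      (\<lambda>L. partial_deriv (partial_deriv f i) j L * g L + partial_deriv f i L * partial_deriv g j L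
        + (partial_deriv f j L * partial_deriv g i L + f L * partial_deriv (partial_deriv g i) j L))"
    for i j
    by (simp add: mult.hyps coord_poly_partial_deriv coord_poly.mult
        partial_deriv_add[of V] partial_deriv_mult[of V])
  show ?case
    unfolding partial_deriv_mult[OF mult.hyps] rule by (simp add: mult.IH algebra_simps)
next
  case (add f g)
  then show ?case
    by (simp add: partial_deriv_add[of V] coord_poly_partial_deriv)
qed (simp_all add: partial_deriv_const partial_deriv_var)

lemma coord_poly_line_deriv:
  assumes "coord_poly V f" "finite V"
  shows "((\<lambda>s. f (\<lambda>j. L j + s * v j)) has_field_derivative (\<Sum>j\<in>V. partial_deriv f j L * v j)) (at 0)"
  using assms(1)
proof induction
  case (const c)
  then show ?case by (simp add: partial_deriv_const)
next
  case (var i)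
  have "(\<Sum>j\<in>V. (if j = i then 1 else 0) * v j) = v i"
    using var assms(2) by (simp add: if_distrib[of "\<lambda>a. a * _"] sum.delta cong: if_cong)
  then show ?case
    by (auto simp: partial_deriv_var intro!: derivative_eq_intros)
next
  case (add f g)
  from DERIV_add[OF add.IH] show ?case
    by (simp add: partial_deriv_add[OF add.hyps] sum.distrib ring_distribs)
next
  case (mult f g)
  from DERIV_mult[OF mult.IH] show ?case
    by (simp add: partial_deriv_mult[OF mult.hyps] sum.distrib ring_distribs
        sum_distrib_left sum_distrib_right mult_ac)
qed

text \<open>The Casimir hypotheses speak about series degree by degree. Only finitely many degrees
  occur in \<open>P\<close>, so such statements add up to one about
  \<open>poly_fun P\<close>.\<close>

lemma poly_fun_eq_sum_hom_part:
  "poly_fun P L =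
    (\<Sum>n\<in>monomial_degree ` Poly_Mapping.keys P. hom_part (Poly_Mapping.lookup P) n L)"
proof -
  have "hom_part (Poly_Mapping.lookup P) n L =
      (\<Sum>m\<in>{m \<in> Poly_Mapping.keys P. monomial_degree m = n}.
        Poly_Mapping.lookup P m * monomial_at m L)" for n
    unfolding hom_part_def hom_terms_def
    by (rule sum.mono_neutral_left) (auto simp: in_keys_iff)
  then show ?thesis
    by (simp only: poly_fun_def) (rule sum.image_gen, simp)
qed

section \<open>Bilinearity and antisymmetry of the bracket\<close>

lemma lie_zero_left: "\<^bold>[0, x\<^bold>] = 0"
  using lie_add_left[of 0 0 x] by simp

lemma lie_zero_right: "\<^bold>[x, 0\<^bold>] = 0"
  using lie_add_right[of x 0 0] by simp

lemma lie_sum_left: "\<^bold>[\<Sum>a\<in>A. f a, x\<^bold>] = (\<Sum>a\<in>A. \<^bold>[f a, x\<^bold>])"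
  by (induction A rule: infinite_finite_induct) (simp_all add: lie_zero_left lie_add_left)

lemma lie_sum_right: "\<^bold>[x, \<Sum>a\<in>A. f a\<^bold>] = (\<Sum>a\<in>A. \<^bold>[x, f a\<^bold>])"
  by (induction A rule: infinite_finite_induct) (simp_all add: lie_zero_right lie_add_right)

lemma lie_diff_left: "\<^bold>[x - y, z\<^bold>] = \<^bold>[x, z\<^bold>] - \<^bold>[y, z\<^bold>]"
  using lie_add_left[of "x - y" y z] by (simp add: algebra_simps)

lemma lie_anticomm: "\<^bold>[y, x\<^bold>] = - \<^bold>[x, y\<^bold>]"
  using lie_self[of "x + y"]
  by (simp add: lie_add_left lie_add_right lie_self[of x] lie_self[of y] eq_neg_iff_add_eq_0 add.commute)

section \<open>Coordinates and the pairing relative to a basis\<close>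

locale based_lie_algebra =
  fixes X :: "'i \<Rightarrow> 'v::complex_lie_algebra" and G :: "'v set"
  assumes basis: "indexed_basis X G"
    and lie_closed: "x \<in> G \<Longrightarrow> y \<in> G \<Longrightarrow> \<^bold>[x, y\<^bold>] \<in> G"
begin

lemma indep: "cvec.independent (range X)" and span: "cvec.span (range X) = G" and inj: "inj X"
  using basis by (auto simp: indexed_basis_def)

lemma subspace: "cvec.subspace G"
  using cvec.subspace_span[of "range X"] by (simp add: span)

text \<open>\<open>representation\<close> is 0 by default outside the span, so \<open>coord\<close>
  and \<open>pairing\<close> are linear in the vector only on \<open>G\<close>. These rules
  discharge the resulting membership conditions.\<close>

lemmas G_closed = cvec.subspace_add[OF subspace] cvec.subspace_scale[OF subspace]
  cvec.subspace_diff[OF subspace] cvec.subspace_0[OF subspace] cvec.subspace_sum[OF subspace]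
  lie_closed

lemma X_in: "X i \<in> G"
  using cvec.span_base[of "X i" "range X"] by (simp add: span)

lemma coord_add: "x \<in> G \<Longrightarrow> y \<in> G \<Longrightarrow> coord X (x + y) i = coord X x i + coord X y i"
  by (simp add: coord_def cvec.representation_add[OF indep] span)

lemma coord_diff: "x \<in> G \<Longrightarrow> y \<in> G \<Longrightarrow> coord X (x - y) i = coord X x i - coord X y i"
  by (simp add: coord_def cvec.representation_diff[OF indep] span)

lemma coord_scale: "x \<in> G \<Longrightarrow> coord X (c *\<^sub>C x) i = c * coord X x i"
  by (simp add: coord_def cvec.representation_scale[OF indep] span)

lemma coord_sum: "(\<And>a. a \<in> A \<Longrightarrow> f a \<in> G) \<Longrightarrow> coord X (\<Sum>a\<in>A. f a) i = (\<Sum>a\<in>A. coord X (f a) i)"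
  by (simp add: coord_def cvec.representation_sum[OF indep] span)

lemma coord_X: "coord X (X j) i = (if i = j then 1 else 0)"
  using cvec.representation_basis[OF indep, of "X j"] inj
  by (auto simp: coord_def inj_eq)

lemma finite_coord: "finite {i. coord X x i \<noteq> 0}"
proof -
  have "finite (X -` {b. cvec.representation (range X) x b \<noteq> 0})"
    by (rule finite_vimageI[OF cvec.finite_representation inj])
  then show ?thesis
    by (simp add: coord_def vimage_def)
qed

lemma coord_expansion: "x \<in> G \<Longrightarrow> (\<Sum>i | coord X x i \<noteq> 0. coord X x i *\<^sub>C X i) = x"
proof -
  assume x: "x \<in> G"
  have eq: "{b. cvec.representation (range X) x b \<noteq> 0} = X ` {i. coord X x i \<noteq> 0}"
    using cvec.representation_ne_zero[of "range X" x] by (auto simp: coord_def)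
  have "(\<Sum>b\<in>X ` {i. coord X x i \<noteq> 0}. cvec.representation (range X) x b *\<^sub>C b) = x"
    using cvec.sum_nonzero_representation_eq[OF indep, of x] x eq by (simp add: span)
  then show ?thesis
    using inj by (simp add: sum.reindex inj_on_def coord_def)
qed

lemma coord_eqI: "x \<in> G \<Longrightarrow> y \<in> G \<Longrightarrow> (\<And>i. coord X x i = coord X y i) \<Longrightarrow> x = y"
  by (subst coord_expansion[of x, symmetric], assumption, subst coord_expansion[of y, symmetric])
    simp_all

lemma coord_combination:
  assumes "finite A" "\<And>i. i \<notin> A \<Longrightarrow> c i = 0"
  shows "coord X (\<Sum>i\<in>A. c i *\<^sub>C X i) j = c j"
proof -
  have "coord X (\<Sum>i\<in>A. c i *\<^sub>C X i) j = (\<Sum>i\<in>A. c i * (if j = i then 1 else 0))"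
    by (simp add: coord_sum G_closed X_in coord_scale coord_X)
  also have "\<dots> = c j"
    using assms by (simp add: if_distrib[of "\<lambda>a. _ * a"] sum.delta' cong: if_cong)
  finally show ?thesis .
qed

lemma pairing_eq_sum:
  assumes "finite A" "\<And>i. i \<notin> A \<Longrightarrow> coord X x i = 0"
  shows "pairing X L x = (\<Sum>i\<in>A. L i * coord X x i)"
  unfolding pairing_def by (rule sum.mono_neutral_left) (use assms in auto)

lemma pairing_add:
  assumes "x \<in> G" "y \<in> G"
  shows "pairing X L (x + y) = pairing X L x + pairing X L y"
proof -
  define A where "A = {i. coord X x i \<noteq> 0} \<union> {i. coord X y i \<noteq> 0}"
  have A: "coord X x i = 0" "coord X y i = 0" if "i \<notin> A" for i
    using that by (auto simp: A_def finite_coord)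
  have "finite A" by (simp add: A_def finite_coord)
  with A show ?thesis
    by (simp add: pairing_eq_sum[of A] coord_add[OF assms] ring_distribs sum.distrib)
qed

lemma pairing_scale:
  assumes "x \<in> G"
  shows "pairing X L (c *\<^sub>C x) = c * pairing X L x"
proof -
  have "pairing X L (c *\<^sub>C x) = (\<Sum>i | coord X x i \<noteq> 0. L i * coord X (c *\<^sub>C x) i)"
    by (rule pairing_eq_sum[OF finite_coord]) (simp add: coord_scale[OF assms])
  then show ?thesis
    by (simp add: coord_scale[OF assms] pairing_def sum_distrib_left mult_ac)
qed

lemma pairing_diff:
  assumes "x \<in> G" "y \<in> G"
  shows "pairing X L (x - y) = pairing X L x - pairing X L y"
  using pairing_add[of "x - y" y L] assms by (simp add: G_closed)

lemma pairing_uminus: "x \<in> G \<Longrightarrow> pairing X L (- x) = - pairing X L x"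
  using pairing_diff[of 0 x L] by (simp add: G_closed pairing_diff[of x x L, simplified])

lemma pairing_sum:
  "finite A \<Longrightarrow> (\<And>a. a \<in> A \<Longrightarrow> f a \<in> G) \<Longrightarrow> pairing X L (\<Sum>a\<in>A. f a) = (\<Sum>a\<in>A. pairing X L (f a))"
proof (induction A rule: finite_induct)
  case empty
  then show ?case using pairing_diff[of 0 0 L] by (simp add: G_closed)
next
  case (insert a A)
  then show ?case by (simp add: pairing_add G_closed)
qed

lemma pairing_add_scale: "pairing X (\<lambda>i. L i + s * M i) x = pairing X L x + s * pairing X M x"
  by (simp add: pairing_def ring_distribs sum.distrib sum_distrib_left mult_ac)

lemma pairing_unit: "pairing X (\<lambda>j. if j = i then 1 else 0) x = coord X x i"
proof -
  have "pairing X (\<lambda>j. if j = i then 1 else 0) x =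
      (\<Sum>j\<in>insert i {j. coord X x j \<noteq> 0}. (if j = i then 1 else 0) * coord X x j)"
    by (rule pairing_eq_sum) (auto simp: finite_coord)
  also have "\<dots> = coord X x i"
    by (simp add: finite_coord if_distrib[of "\<lambda>a. a * _"] sum.delta cong: if_cong)
  finally show ?thesis .
qed

text \<open>Both \<open>coad\<close> and \<open>dual_op\<close> give a functional by its values on
  the basis. The finite expansion of \<open>x\<close> extends the formula to all of
  \<open>G\<close>; the uses have \<open>T\<close> a bracket with a fixed element, or
  \<open>R\<close>.\<close>

lemma pairing_linear_functional:
  assumes "x \<in> G"
    and mem: "\<And>y. y \<in> G \<Longrightarrow> T y \<in> G"
    and add: "\<And>y z. y \<in> G \<Longrightarrow> z \<in> G \<Longrightarrow> T (y + z) = T y + T z"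
    and scale: "\<And>c y. y \<in> G \<Longrightarrow> T (c *\<^sub>C y) = c *\<^sub>C T y"
  shows "pairing X (\<lambda>i. pairing X L (T (X i))) x = pairing X L (T x)"
proof -
  have T0: "T 0 = 0" using scale[of 0 0] by (simp add: G_closed)
  have sumT: "T (\<Sum>a\<in>A. f a) = (\<Sum>a\<in>A. T (f a))" if "finite A" "\<And>a. a \<in> A \<Longrightarrow> f a \<in> G" for A and f :: "'i \<Rightarrow> 'v"
    using that by (induction A rule: finite_induct) (auto simp: T0 add G_closed)
  have "pairing X L (T x) = pairing X L (T (\<Sum>i | coord X x i \<noteq> 0. coord X x i *\<^sub>C X i))"
    by (simp add: coord_expansion assms)
  also have "\<dots> = (\<Sum>i | coord X x i \<noteq> 0. coord X x i * pairing X L (T (X i)))"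
    by (simp add: sumT finite_coord X_in G_closed scale pairing_sum mem pairing_scale)
  finally show ?thesis
    by (simp add: pairing_def[of X "\<lambda>i. pairing X L (T (X i))"] mult.commute)
qed

lemma pairing_coad:
  assumes "x \<in> G" "y \<in> G"
  shows "pairing X (coad X x L) y = - pairing X L \<^bold>[x, y\<^bold>]"
proof -
  have "pairing X (\<lambda>i. pairing X L \<^bold>[x, X i\<^bold>]) y = pairing X L \<^bold>[x, y\<^bold>]"
    by (rule pairing_linear_functional)
      (use assms in \<open>auto simp: G_closed lie_add_right lie_cscale_right\<close>)
  then show ?thesis
    by (simp add: coad_def pairing_def sum_negf)
qed

section \<open>Gradients, Poisson brackets and flow derivatives of polynomials\<close>

lemma gradient_eq_sum:
  assumes "coord_poly V f" "finite V"
  shows "gradient X f L = (\<Sum>i\<in>V. partial_deriv f i L *\<^sub>C X i)"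
  unfolding gradient_def
  by (rule sum.mono_neutral_left) (use assms(2) partial_deriv_eq_0[OF assms(1)] in auto)

lemma gradient_in: "coord_poly V f \<Longrightarrow> finite V \<Longrightarrow> gradient X f L \<in> G"
  by (simp add: gradient_eq_sum G_closed X_in)

lemma coord_gradient: "coord_poly V f \<Longrightarrow> finite V \<Longrightarrow> coord X (gradient X f L) i = partial_deriv f i L"
  by (simp add: gradient_eq_sum coord_combination partial_deriv_eq_0)

text \<open>The gradient represents the differential, which turns invariance along a direction into
  orthogonality to it.\<close>

lemma line_deriv_eq_pairing_gradient:
  assumes "coord_poly V f" "finite V"
  shows "((\<lambda>s. f (\<lambda>j. L j + s * M j)) has_field_derivative pairing X M (gradient X f L)) (at 0)"
proof -
  have "pairing X M (gradient X f L) = (\<Sum>j\<in>V. partial_deriv f j L * M j)"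
    using assms
    by (subst pairing_eq_sum[of V]) (auto simp: coord_gradient partial_deriv_eq_0 mult.commute)
  then show ?thesis
    using coord_poly_line_deriv[OF assms] by simp
qed

text \<open>The dependence on \<open>L\<close> becomes explicit: polynomial coefficients times
  pairings that are linear in \<open>L\<close>. This form can be differentiated and
  truncated.\<close>

lemma lie_poisson_eq_sum:
  assumes "coord_poly V f" "coord_poly V h" "finite V"
  shows "lie_poisson X f h L =
    (\<Sum>a\<in>V. \<Sum>b\<in>V. partial_deriv f a L * partial_deriv h b L * pairing X L \<^bold>[X a, X b\<^bold>])"
  unfolding lie_poisson_def gradient_eq_sum[OF assms(1,3)] gradient_eq_sum[OF assms(2,3)]
  using assms(3)
  by (simp add: lie_sum_left lie_sum_right lie_cscale_left lie_cscale_right pairing_sum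
      pairing_scale G_closed X_in cscale_cscale mult_ac sum_distrib_left) (rule sum.swap)

lemma hamiltonian_velocity_eq_sum:
  assumes "coord_poly V h" "finite V"
  shows "hamiltonian_velocity X h L j = (\<Sum>b\<in>V. partial_deriv h b L * pairing X L \<^bold>[X j, X b\<^bold>])"
proof -
  have "gradient X (\<lambda>M. M j) L = X j"
    using gradient_eq_sum[OF coord_poly.var[of j "{j}"]] by (simp add: partial_deriv_var cscale_one)
  then show ?thesis
    unfolding hamiltonian_velocity_def lie_poisson_def gradient_eq_sum[OF assms]
    by (simp add: lie_sum_right lie_cscale_right pairing_sum pairing_scale G_closed X_in assms)
qed

lemma flow_deriv_coord_gradient:
  assumes "coord_poly V f" "finite V"
  shows "flow_deriv_coord X h (gradient X f) L i =
    (\<Sum>j\<in>V. partial_deriv (partial_deriv f i) j L * hamiltonian_velocity X h L j)"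
  unfolding flow_deriv_coord_def coord_gradient[OF assms]
  by (rule DERIV_imp_deriv coord_poly_line_deriv coord_poly_partial_deriv assms)+

lemma flow_deriv_gradient:
  assumes "coord_poly V f" "finite V"
  shows "flow_deriv X h (gradient X f) L \<in> G"
    and "coord X (flow_deriv X h (gradient X f) L) i =
      (\<Sum>j\<in>V. partial_deriv (partial_deriv f i) j L * hamiltonian_velocity X h L j)"
proof -
  \<comment> \<open>This makes the support finite; a sum over an infinite support would be 0 by
    default.\<close>
  have "flow_deriv_coord X h (gradient X f) L j = 0" if "j \<notin> V" for j
  proof -
    have "partial_deriv f j = (\<lambda>L. 0)"
      using partial_deriv_eq_0[OF assms(1) that] by auto
    then show ?thesis
      by (simp add: flow_deriv_coord_gradient[OF assms] partial_deriv_const)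
  qed
  then have fin: "finite {j. flow_deriv_coord X h (gradient X f) L j \<noteq> 0}"
    by (intro finite_subset[OF _ assms(2)]) auto
  show "flow_deriv X h (gradient X f) L \<in> G"
    by (simp add: flow_deriv_def G_closed X_in)
  show "coord X (flow_deriv X h (gradient X f) L) i =
      (\<Sum>j\<in>V. partial_deriv (partial_deriv f i) j L * hamiltonian_velocity X h L j)"
    unfolding flow_deriv_coord_gradient[OF assms, symmetric] flow_deriv_def
    using fin by (intro coord_combination) auto
qed

text \<open>
  The left-hand side of the zero-curvature equation is the gradient of \<open>{f, h}\<close>.
\<close>

lemma zero_curvature_of_involution:
  assumes f: "coord_poly V f" and h: "coord_poly V h" and V: "finite V"
    and comm: "\<And>L. lie_poisson X f h L = 0"
  shows "flow_deriv X h (gradient X f) L - flow_deriv X f (gradient X h) L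
    + \<^bold>[gradient X f L, gradient X h L\<^bold>] = 0"
proof (rule coord_eqI)
  note mem = flow_deriv_gradient(1)[OF f V] flow_deriv_gradient(1)[OF h V]
    gradient_in[OF f V] gradient_in[OF h V]
  show "flow_deriv X h (gradient X f) L - flow_deriv X f (gradient X h) L
    + \<^bold>[gradient X f L, gradient X h L\<^bold>] \<in> G"
    by (intro G_closed mem)
  show "0 \<in> G" by (rule G_closed)
  fix i
  \<comment> \<open>\<open>e\<close> is the dual basis element with index \<open>i\<close>;
    differentiating the Poisson bracket along it gives coordinate \<open>i\<close> of its gradient.
    The structure constants \<open>c\<close> are the derivative of \<open>w\<close> along
    \<open>e\<close>, because the pairing is linear in \<open>L\<close>.\<close>
  define e :: "'i \<Rightarrow> complex" where "e = (\<lambda>j. if j = i then 1 else 0)"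
  define w where "w = (\<lambda>a b. pairing X L \<^bold>[X a, X b\<^bold>])"
  define c where "c = (\<lambda>a b. coord X \<^bold>[X a, X b\<^bold>] i)"
  \<comment> \<open>Symmetry of second derivatives puts \<open>i\<close> innermost, because
    \<open>flow_deriv\<close> differentiates the \<open>i\<close>-th coordinate of the
    gradient.\<close>
  have d: "((\<lambda>s. partial_deriv g a (\<lambda>j. L j + s * e j)) has_field_derivative
      partial_deriv (partial_deriv g i) a L) (at 0)" if g: "coord_poly V g" for g a
  proof -
    have "(\<Sum>j\<in>V. partial_deriv (partial_deriv g a) j L * e j) = partial_deriv (partial_deriv g a) i L"
      using V partial_deriv_eq_0[OF coord_poly_partial_deriv[OF g]]
      by (auto simp: e_def if_distrib[of "\<lambda>a. _ * a"] sum.delta cong: if_cong)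
    then show ?thesis
      using coord_poly_line_deriv[OF coord_poly_partial_deriv[OF g] V, of a L e]
      by (simp add: partial_deriv_commute[OF g, of i])
  qed
  have "((\<lambda>s. lie_poisson X f h (\<lambda>j. L j + s * e j)) has_field_derivative
      (\<Sum>a\<in>V. \<Sum>b\<in>V. (partial_deriv (partial_deriv f i) a L * partial_deriv h b L
          + partial_deriv f a L * partial_deriv (partial_deriv h i) b L) * w a b
        + partial_deriv f a L * partial_deriv h b L * c a b)) (at 0)"
    unfolding lie_poisson_eq_sum[OF f h V] pairing_add_scale w_def c_def
    by (rule derivative_eq_intros d f h refl ext)+
      (simp add: e_def pairing_unit algebra_simps)
  moreover have "((\<lambda>s. lie_poisson X f h (\<lambda>j. L j + s * e j)) has_field_derivative 0) (at 0)"
    by (simp add: comm)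
  ultimately have "(\<Sum>a\<in>V. \<Sum>b\<in>V. (partial_deriv (partial_deriv f i) a L * partial_deriv h b L
          + partial_deriv f a L * partial_deriv (partial_deriv h i) b L) * w a b
        + partial_deriv f a L * partial_deriv h b L * c a b) = 0"
    by (rule DERIV_unique)
  \<comment> \<open>The three sums belong, in order, to the two flow derivatives and to the bracket
    of the gradients; the minus sign of the second comes from the antisymmetry of
    \<open>w\<close>.\<close>
  then have sum0: "(\<Sum>a\<in>V. \<Sum>b\<in>V. partial_deriv (partial_deriv f i) a L * (partial_deriv h b L * w a b))
      + (\<Sum>a\<in>V. \<Sum>b\<in>V. partial_deriv (partial_deriv h i) b L * (partial_deriv f a L * w a b))
      + (\<Sum>a\<in>V. \<Sum>b\<in>V. partial_deriv f a L * partial_deriv h b L * c a b) = 0"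
    by (simp add: sum.distrib ring_distribs mult_ac)
  have w_anti: "w b a = - w a b" for a b
    unfolding w_def by (subst lie_anticomm) (simp add: pairing_uminus G_closed X_in)
  have 1: "coord X (flow_deriv X h (gradient X f) L) i =
      (\<Sum>a\<in>V. \<Sum>b\<in>V. partial_deriv (partial_deriv f i) a L * (partial_deriv h b L * w a b))"
    by (simp add: flow_deriv_gradient(2)[OF f V] hamiltonian_velocity_eq_sum[OF h V] w_def
        sum_distrib_left)
  have "coord X (flow_deriv X f (gradient X h) L) i =
      (\<Sum>b\<in>V. \<Sum>a\<in>V. partial_deriv (partial_deriv h i) b L * (partial_deriv f a L * w b a))"
    by (simp add: flow_deriv_gradient(2)[OF h V] hamiltonian_velocity_eq_sum[OF f V] w_def
        sum_distrib_left)
  also have "\<dots> = - (\<Sum>a\<in>V. \<Sum>b\<in>V. partial_deriv (partial_deriv h i) b L * (partial_deriv f a L * w a b))"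
    by (subst sum.swap, subst w_anti) (simp add: sum_negf)
  finally have 2: "coord X (flow_deriv X f (gradient X h) L) i = \<dots>" .
  have 3: "coord X \<^bold>[gradient X f L, gradient X h L\<^bold>] i =
      (\<Sum>a\<in>V. \<Sum>b\<in>V. partial_deriv f a L * partial_deriv h b L * c a b)"
    unfolding gradient_eq_sum[OF f V] gradient_eq_sum[OF h V] c_def
    by (simp add: lie_sum_left lie_sum_right lie_cscale_left lie_cscale_right coord_sum
      coord_scale G_closed X_in cscale_cscale mult_ac sum_distrib_left) (rule sum.swap)
  have "coord X (flow_deriv X h (gradient X f) L - flow_deriv X f (gradient X h) L
      + \<^bold>[gradient X f L, gradient X h L\<^bold>]) i = 0"
    using sum0 by (simp add: coord_add coord_diff G_closed mem 1 2 3)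
  then show "coord X (flow_deriv X h (gradient X f) L - flow_deriv X f (gradient X h) L
      + \<^bold>[gradient X f L, gradient X h L\<^bold>]) i = coord X 0 i"
    using coord_scale[of 0 0 i] by (simp add: G_closed)
qed

text \<open>The gradients and the pairings with the finitely many relevant brackets of basis
  elements see only finitely many coordinates of \<open>L\<close>; setting the others to 0 leaves
  the Poisson bracket unchanged. This lifts involution from finitely supported forms to all
  \<open>L\<close>.\<close>

lemma lie_poisson_eq_0_of_finite_support:
  assumes f: "coord_poly V f" and h: "coord_poly V h" and V: "finite V"
    and fin: "\<And>M. finite {i. M i \<noteq> 0} \<Longrightarrow> lie_poisson X f h M = 0"
  shows "lie_poisson X f h L = 0"
proof -
  define S where "S = V \<union> (\<Union>a\<in>V. \<Union>b\<in>V. {i. coord X \<^bold>[X a, X b\<^bold>] i \<noteq> 0})"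
  define M where "M = (\<lambda>i. if i \<in> S then L i else 0)"
  have "finite S" using V by (auto simp: S_def finite_coord)
  then have "finite {i. M i \<noteq> 0}"
    by (rule rev_finite_subset) (auto simp: M_def)
  moreover have "partial_deriv g a L = partial_deriv g a M" if "coord_poly V g" for g a
    by (rule coord_poly_cong[OF coord_poly_partial_deriv[OF that]]) (simp add: M_def S_def)
  moreover have "pairing X L \<^bold>[X a, X b\<^bold>] = pairing X M \<^bold>[X a, X b\<^bold>]" if "a \<in> V" "b \<in> V" for a b
    unfolding pairing_def by (rule sum.cong) (use that in \<open>auto simp: M_def S_def\<close>)
  ultimately show ?thesis
    using fin[of M] f h by (simp add: lie_poisson_eq_sum[OF f h V])
qed

end

section \<open>The \<open>R\<close>-operator and the dual space\<close>

locale R_lie_algebra = based_lie_algebra X G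
  for X :: "'i \<Rightarrow> 'v::complex_lie_algebra" and G :: "'v set" +
  fixes R :: "'v \<Rightarrow> 'v" and D :: "('i \<Rightarrow> complex) set"
  assumes R_op: "classical_R_operator G R"
    and dual: "is_dual_space X G R D"
begin

lemma R_in: "x \<in> G \<Longrightarrow> R x \<in> G"
  and R_add: "x \<in> G \<Longrightarrow> y \<in> G \<Longrightarrow> R (x + y) = R x + R y"
  and R_scale: "x \<in> G \<Longrightarrow> R (c *\<^sub>C x) = c *\<^sub>C R x"
  and R_lie: "x \<in> G \<Longrightarrow> y \<in> G \<Longrightarrow> R (\<^bold>[R x, y\<^bold>] + \<^bold>[x, R y\<^bold>]) - \<^bold>[R x, R y\<^bold>] = \<^bold>[x, y\<^bold>]"
  using R_op by (auto simp: classical_R_operator_def)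

lemma R_uminus:
  assumes "x \<in> G"
  shows "R (- x) = - R x"
proof -
  have "R 0 = 0"
    using R_scale[of 0 0] by (simp add: G_closed)
  then have "R x + R (- x) = 0"
    using R_add[of x "- x"] assms cvec.subspace_neg[OF subspace assms] by simp
  then show ?thesis
    by (rule minus_unique[symmetric])
qed

lemma D_add_scale: "L \<in> D \<Longrightarrow> M \<in> D \<Longrightarrow> (\<lambda>i. L i + s * M i) \<in> D"
  using dual by (simp add: is_dual_space_def)

lemma D_coad: "x \<in> G \<Longrightarrow> L \<in> D \<Longrightarrow> coad X x L \<in> D"
  and D_dual_op: "L \<in> D \<Longrightarrow> dual_op X R L \<in> D"
  using dual by (auto simp: is_dual_space_def)

lemma finite_support_in_D:
  assumes "finite {i. L i \<noteq> 0}"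
  shows "L \<in> D"
proof -
  have unit: "(\<lambda>i. if i = j then 1 else 0) \<in> D" for j
    using dual by (simp add: is_dual_space_def)
  have "(\<lambda>i. if i \<in> A then L i else 0) \<in> D" if "finite A" for A
    using that
  proof (induction A rule: finite_induct)
    case empty
    show ?case
      \<comment> \<open>The zero family is obtained as a dual basis element minus itself; the index
        is arbitrary.\<close>
      using D_add_scale[OF unit unit, of undefined "-1" undefined] by simp
  next
    case (insert a A)
    have "(\<lambda>i. if i \<in> insert a A then L i else 0) =
        (\<lambda>i. (if i \<in> A then L i else 0) + L a * (if i = a then 1 else 0))"
      using insert.hyps by auto
    then show ?case
      using D_add_scale[OF insert.IH unit] by simp
  qed
  from this[OF assms] show ?thesis
    by (rule back_subst[of "\<lambda>L. L \<in> D"]) auto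
qed

lemma pairing_dual_op: "x \<in> G \<Longrightarrow> pairing X (dual_op X R L) x = pairing X L (R x)"
  unfolding dual_op_def by (rule pairing_linear_functional) (auto simp: R_in R_add R_scale)

section \<open>The shifted dual operator and involution of the Hamiltonians\<close>

definition shift :: "complex \<Rightarrow> ('i \<Rightarrow> complex) \<Rightarrow> 'i \<Rightarrow> complex"
  where "shift \<sigma> L = (\<lambda>i. dual_op X R L i + \<sigma> * L i)"

lemma shift_add_scale: "shift \<sigma> (\<lambda>i. L i + s * M i) = (\<lambda>i. shift \<sigma> L i + s * shift \<sigma> M i)"
  by (simp add: shift_def dual_op_def pairing_add_scale algebra_simps)

lemma shift_in_D: "L \<in> D \<Longrightarrow> shift \<sigma> L \<in> D"
  unfolding shift_def by (intro D_add_scale D_dual_op)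

lemma pairing_shift: "x \<in> G \<Longrightarrow> pairing X (shift \<sigma> L) x = pairing X L (R x) + \<sigma> * pairing X L x"
  unfolding shift_def by (simp add: pairing_add_scale pairing_dual_op)

lemma shift_nth: "shift \<sigma> L i = pairing X (shift \<sigma> L) (X i)"
  by (simp add: shift_def dual_op_def pairing_def coord_X)

text \<open>
  The series may be undefined off the image of \<open>R\<^sup>* + \<sigma>\<close>, in particular on the coadjoint orbit
  of \<open>(R\<^sup>* + \<sigma>) L\<close>, so its invariance is only usable in those coadjoint directions that lie in
  that image.
\<close>

lemma pairing_gradient_eq_0:
  assumes cas: "casimir X G D c" and P: "R_shift_is_poly X R D c \<sigma> P"
    and f: "coord_poly V (poly_fun P)" "finite V"
    and L: "L \<in> D" and M: "M \<in> D" and x: "x \<in> G"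
    and dir: "shift \<sigma> M = coad X x (shift \<sigma> L)"
  shows "pairing X M (gradient X (poly_fun P) L) = 0"
proof -
  have line: "(\<lambda>i. shift \<sigma> L i + s * coad X x (shift \<sigma> L) i) = shift \<sigma> (\<lambda>i. L i + s * M i)" for s
    by (simp add: shift_add_scale dir)
  have P': "defined_at c (shift \<sigma> N)"
      "hom_part c n (shift \<sigma> N) = hom_part (Poly_Mapping.lookup P) n N" if "N \<in> D" for N n
    using P that unfolding R_shift_is_poly_def shift_def by blast+
  note LM = D_add_scale[OF L M]
  \<comment> \<open>Invariance is granted only if the series is defined on the entire coadjoint
    line. By \<open>line\<close>, each point of it is the shift of a member of
    \<open>D\<close>.\<close>
  have "\<forall>s. defined_at c (\<lambda>i. shift \<sigma> L i + s * coad X x (shift \<sigma> L) i)"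
    unfolding line by (intro allI P'(1)[OF LM])
  then have "((\<lambda>s. hom_part c n (\<lambda>i. shift \<sigma> L i + s * coad X x (shift \<sigma> L) i))
      has_field_derivative 0) (at 0)" for n
    using cas shift_in_D[OF L, of \<sigma>] x unfolding casimir_def by blast
  then have "((\<lambda>s. hom_part (Poly_Mapping.lookup P) n (\<lambda>i. L i + s * M i))
      has_field_derivative 0) (at 0)" for n
    unfolding line P'(2)[OF LM] .
  then have "((\<lambda>s. poly_fun P (\<lambda>i. L i + s * M i)) has_field_derivative
      (\<Sum>n\<in>monomial_degree ` Poly_Mapping.keys P. 0)) (at 0)"
    unfolding poly_fun_eq_sum_hom_part by (intro DERIV_sum)
  then show ?thesis
    using DERIV_unique[OF line_deriv_eq_pairing_gradient[OF f]] by simp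
qed

text \<open>
  By the equation for \<open>R\<close>, \<open>coad\<^sub>x (R\<^sup>* + \<sigma>) L\<close> with \<open>x = (R - \<sigma>) y\<close> is the image under \<open>R\<^sup>* + \<sigma>\<close> of
  \<open>coad\<^bsub>R y\<^esub> L - coad\<^sub>y (R\<^sup>* L)\<close>. The resulting identity no longer involves \<open>\<sigma>\<close>.
\<close>

lemma pairing_gradient_R:
  assumes cas: "casimir X G D c" and P: "R_shift_is_poly X R D c \<sigma> P" and \<sigma>: "\<sigma> * \<sigma> = 1"
    and f: "coord_poly V (poly_fun P)" "finite V"
    and L: "L \<in> D" and y: "y \<in> G"
  shows "pairing X L \<^bold>[gradient X (poly_fun P) L, R y\<^bold>] =
    pairing X L (R \<^bold>[gradient X (poly_fun P) L, y\<^bold>])"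
proof -
  define M where "M = (\<lambda>i. coad X (R y) L i + (-1) * coad X y (dual_op X R L) i)"
  define x where "x = R y - \<sigma> *\<^sub>C y"
  let ?f = "gradient X (poly_fun P) L"
  have M: "M \<in> D"
    unfolding M_def by (intro D_add_scale D_coad D_dual_op R_in L y)
  have x: "x \<in> G"
    unfolding x_def by (intro G_closed R_in y)
  have pM: "pairing X M z = pairing X L (R \<^bold>[y, z\<^bold>]) - pairing X L \<^bold>[R y, z\<^bold>]" if "z \<in> G" for z
    unfolding M_def pairing_add_scale
    using that y by (simp add: pairing_coad R_in G_closed pairing_dual_op)
  have "shift \<sigma> M i = coad X x (shift \<sigma> L) i" for i
  proof -
    let ?z = "X i"
    note mem = y X_in[of i] R_in G_closed
    have 1: "pairing X L \<^bold>[y, ?z\<^bold>] = pairing X L (R \<^bold>[R y, ?z\<^bold>]) + pairing X L (R \<^bold>[y, R ?z\<^bold>])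
        - pairing X L \<^bold>[R y, R ?z\<^bold>]"
      by (subst R_lie[symmetric]) (simp_all add: mem pairing_diff pairing_add R_add)
    have 2: "shift \<sigma> M i = pairing X L (R \<^bold>[y, R ?z\<^bold>]) - pairing X L \<^bold>[R y, R ?z\<^bold>]
        + \<sigma> * (pairing X L (R \<^bold>[y, ?z\<^bold>]) - pairing X L \<^bold>[R y, ?z\<^bold>])"
      by (simp add: shift_nth[of \<sigma> M] pairing_shift pM mem)
    have 3: "coad X x (shift \<sigma> L) i = - (pairing X L (R \<^bold>[R y, ?z\<^bold>]) - \<sigma> * pairing X L (R \<^bold>[y, ?z\<^bold>])
        + (\<sigma> * pairing X L \<^bold>[R y, ?z\<^bold>] - (\<sigma> * \<sigma>) * pairing X L \<^bold>[y, ?z\<^bold>]))"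
    proof -
      have "pairing X L (R (\<^bold>[R y, ?z\<^bold>] - \<sigma> *\<^sub>C \<^bold>[y, ?z\<^bold>])) =
          pairing X L (R \<^bold>[R y, ?z\<^bold>]) - \<sigma> * pairing X L (R \<^bold>[y, ?z\<^bold>])"
        using R_add[of "\<^bold>[R y, ?z\<^bold>] - \<sigma> *\<^sub>C \<^bold>[y, ?z\<^bold>]" "\<sigma> *\<^sub>C \<^bold>[y, ?z\<^bold>]"]
        by (simp add: mem R_scale pairing_add pairing_scale)
      then show ?thesis
        by (simp add: coad_def x_def lie_diff_left lie_cscale_left pairing_shift mem
            pairing_diff pairing_scale right_diff_distrib distrib_left)
    qed
    \<comment> \<open>Since \<sigma> squares to 1, the bracket of \<open>y\<close> and
      \<open>?z\<close> enters with coefficient 1, and the equation for \<open>R\<close> in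
      \<open>1\<close> eliminates it. The terms linear in \<sigma> already agree.\<close>
    show ?thesis
      unfolding 2 3 \<sigma> by (simp add: 1 right_diff_distrib)
  qed
  then have "pairing X M ?f = 0"
    by (intro pairing_gradient_eq_0[OF cas P f L M x] ext)
  then have "pairing X L (R \<^bold>[y, ?f\<^bold>]) = pairing X L \<^bold>[R y, ?f\<^bold>]"
    by (simp add: pM gradient_in[OF f])
  moreover have "pairing X L \<^bold>[?f, R y\<^bold>] = - pairing X L \<^bold>[R y, ?f\<^bold>]"
    unfolding lie_anticomm[of ?f "R y"]
    by (rule pairing_uminus) (intro lie_closed R_in y gradient_in[OF f])
  moreover have "pairing X L (R \<^bold>[?f, y\<^bold>]) = - pairing X L (R \<^bold>[y, ?f\<^bold>])"
    unfolding lie_anticomm[of ?f y] R_uminus[OF lie_closed[OF y gradient_in[OF f]]]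
    by (rule pairing_uminus) (intro lie_closed R_in y gradient_in[OF f])
  ultimately show ?thesis by simp
qed

text \<open>The shifts \<sigma> and \<tau> are independent, so equal and opposite signs are covered
  together. The gradient of the first Hamiltonian supplies a coadjoint direction, and the invariance
  of the second series is applied along it.\<close>

lemma lie_poisson_eq_0:
  assumes cas: "casimir X G D c" "casimir X G D c'"
    and P: "R_shift_is_poly X R D c \<sigma> P" "R_shift_is_poly X R D c' \<tau> Q"
    and \<sigma>: "\<sigma> * \<sigma> = 1"
    and f: "coord_poly V (poly_fun P)" and h: "coord_poly V (poly_fun Q)" and V: "finite V"
    and L: "L \<in> D"
  shows "lie_poisson X (poly_fun P) (poly_fun Q) L = 0"
proof -
  let ?f = "gradient X (poly_fun P) L"
  have fG: "?f \<in> G" by (rule gradient_in[OF f V])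
  \<comment> \<open>\<open>pairing_gradient_R\<close> says that the coadjoint action of
    \<open>?f\<close> commutes with \<open>R^*\<close> at \<open>L\<close>; it also commutes with
    multiplication by \<tau>.\<close>
  have "shift \<tau> (coad X ?f L) i = coad X ?f (shift \<tau> L) i" for i
    using pairing_gradient_R[OF cas(1) P(1) \<sigma> f V L X_in[of i]]
    by (simp add: shift_nth[of \<tau> "coad X ?f L"] pairing_shift pairing_coad X_in R_in fG G_closed)
      (simp add: coad_def pairing_shift X_in fG G_closed)
  then have "pairing X (coad X ?f L) (gradient X (poly_fun Q) L) = 0"
    by (intro pairing_gradient_eq_0[OF cas(2) P(2) h V L D_coad[OF fG L] fG] ext)
  then show ?thesis
    by (simp add: pairing_coad fG gradient_in[OF h V] lie_poisson_def)
qed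

text \<open>\<open>D\<close> need not contain \<open>L\<close>. Involution on \<open>D\<close>
  covers the finitely supported forms, hence all points, as the differentiation of the Poisson
  bracket requires.\<close>

lemma zero_curvature:
  assumes cas: "casimir X G D c" "casimir X G D c'"
    and P: "R_shift_is_poly X R D c \<sigma> P" "R_shift_is_poly X R D c' \<tau> Q"
    and \<sigma>: "\<sigma> * \<sigma> = 1"
  shows "flow_deriv X (poly_fun Q) (gradient X (poly_fun P)) L
    - flow_deriv X (poly_fun P) (gradient X (poly_fun Q)) L
    + \<^bold>[gradient X (poly_fun P) L, gradient X (poly_fun Q) L\<^bold>] = 0"
proof -
  define V where "V = (\<Union>m\<in>Poly_Mapping.keys P \<union> Poly_Mapping.keys Q. Poly_Mapping.keys m)"
  have V: "finite V" by (simp add: V_def)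
  have f: "coord_poly V (poly_fun P)" and h: "coord_poly V (poly_fun Q)"
    by (rule coord_poly_poly_fun; auto simp: V_def)+
  show ?thesis
    by (rule zero_curvature_of_involution[OF f h V],
        rule lie_poisson_eq_0_of_finite_support[OF f h V],
        rule lie_poisson_eq_0[OF cas P \<sigma> f h V], rule finite_support_in_D)
qed

end

theorem theorem2:
  fixes G :: "(complex \<Rightarrow> 'g::complex_lie_algebra) set"
    and X :: "'i \<Rightarrow> complex \<Rightarrow> 'g"
    and R :: "(complex \<Rightarrow> 'g) \<Rightarrow> complex \<Rightarrow> 'g"
    and D :: "('i \<Rightarrow> complex) set"
    and I :: "'k \<Rightarrow> 'i fseries"
    and P :: "complex \<Rightarrow> 'k \<Rightarrow> 'i fpoly"
  defines "IR \<equiv> \<lambda>\<sigma> k. poly_fun (P \<sigma> k)"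
  assumes "semisimple_lie_algebra TYPE('g)"
    and "infinite_dim_function_lie_algebra G"
    and "indexed_basis X G"
    and "classical_R_operator G R"
    and "is_dual_space X G R D"
    and "\<And>k. casimir X G D (I k)"
    and "\<And>k \<sigma>. \<sigma> \<in> {1, -1} \<Longrightarrow> R_shift_is_poly X R D (I k) \<sigma> (P \<sigma> k)"
  shows "\<forall>\<sigma>\<in>{1, -1}. \<forall>k l. \<forall>L :: 'i \<Rightarrow> complex.
      flow_deriv X (IR \<sigma> l) (gradient X (IR \<sigma> k)) L
      - flow_deriv X (IR \<sigma> k) (gradient X (IR \<sigma> l)) L
      + \<^bold>[gradient X (IR \<sigma> k) L, gradient X (IR \<sigma> l) L\<^bold>] = 0 \<and>
      flow_deriv X (IR (- \<sigma>) l) (gradient X (IR \<sigma> k)) L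
      - flow_deriv X (IR \<sigma> k) (gradient X (IR (- \<sigma>) l)) L
      + \<^bold>[gradient X (IR \<sigma> k) L, gradient X (IR (- \<sigma>) l) L\<^bold>] = 0"
proof -
  have "\<^bold>[x, y\<^bold>] \<in> G" if "x \<in> G" "y \<in> G" for x y
    using assms(3) that by (simp add: infinite_dim_function_lie_algebra_def)
  then interpret R_lie_algebra X G R D
    using assms(4-6) by unfold_locales
  \<comment> \<open>Negation stays within the two signs, so the mixed equation is another instance
    of \<open>zero_curvature\<close>.\<close>
  have "- \<sigma> \<in> {1, -1}" "\<sigma> * \<sigma> = 1" if "\<sigma> \<in> {1, -1 :: complex}" for \<sigma>
    using that by auto
  then show ?thesis
    unfolding IR_def by (intro ballI allI conjI zero_curvature[OF assms(7) assms(7) assms(8) assms(8)])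
qed

end
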